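(* Let $A\in\mathbb{R}^{m\times n}$ be nonzero and $b\in\mathbb{R}^m$. Let $\rho>0$ be a constant and let $\mathcal{D}$ be a distribution of random matrix quadruples $(S_1,S_2,T_1,T_2)$ with $S_1=S_2=\sqrt{\rho}\, I$ and satisfying $\mathbb{E}[T_1T_2^\top A^\top S_1S_2^\top]=\frac{A^\top}{\|A\|_F^2}$. Let $x_{LS}^*=A^\dagger b$, let $x^1=x^0\in\mathbb{R}^n$ be (deterministic) initial vectors, and let $\{x^k\}$ be generated by the mPFR iteration $$x^{k+1}=x^{k}-\alpha T_1T_2^\top A^\top S_1S_2^\top(Ax^{k}-b)+\omega(x^k-x^{k-1}),\qquad k\ge 1,$$ where at each iteration a fresh quadruple $(S_1,S_2,T_1,T_2)$ is drawn independently from $\mathcal{D}$. Denote $r^*=Ax_{LS}^*-b$, $r^k=Ax^k-b$, and $$\beta_2=\big\|\mathbb{E}[ T_2T_1^\top A^\top A T_1T_2^\top ]\big\|_2.$$ Assume $0<\alpha<\frac{2}{\rho^2\beta_2\|A\|^2_F}$, $\omega\geq0$, and that the expressions $$\gamma_1=1+3\omega+2\omega^2-\left(2\alpha-\alpha^2\rho^2\beta_2\|A\|^2_F+\alpha\omega\right)\frac{\sigma_{\min}^2(A)}{\|A\|^2_F}\quad\text{and}\quad\gamma_2=2\omega^2+\omega+\omega\alpha\frac{\sigma^2_{\max}(A)}{\|A\|^2_F}$$ satisfy $\gamma_1+\gamma_2<1$. Then $$\mathbb{E}[\|r^{k+1}-r^*\|^2_2]\leq q^k(1+\tau)\|r^0-r^*\|^2_2\qquad\text{for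 all } k\geq 0,$$ where $q=\frac{\gamma_1+\sqrt{\gamma_1^2+4\gamma_2}}{2}$ if $\omega>0$, $q=\gamma_1$ if $\omega=0$, and $\tau=q-\gamma_1\geq 0$. Moreover, $\gamma_1+\gamma_2\leq q<1$.
   Context: $A^\dagger$ is the Moore-Penrose pseudoinverse; $\|\cdot\|_F$ is the Frobenius norm; $\|\cdot\|_2$ is the Euclidean norm of a vector or the spectral norm of a matrix; $\sigma_{\max}(A)$ is the largest singular value and $\sigma_{\min}(A)$ the smallest nonzero singular value of $A$. The linear system $Ax=b$ may be consistent or inconsistent and $A$ may have any rank. Here $I$ is the $m\times m$ identity, and $T_1,T_2\in\mathbb{R}^{n\times s}$, where $s$ may itself be random; $T_1,T_2$ need not be independent of each other, but the samples used at different iterations are independent and identically distributed. All expectations appearing are assumed to exist and be finite. *)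

theory Defs
  imports "HOL-Probability.Probability"
begin

definition frobenius_norm :: "real^'n^'m \<Rightarrow> real"
  where "frobenius_norm A = sqrt (\<Sum>i\<in>UNIV. \<Sum>j\<in>UNIV. (A $ i $ j)\<^sup>2)"

text \<open>The operator norm induced by the Euclidean norms.\<close>

definition spectral_norm :: "real^'n^'m \<Rightarrow> real"
  where "spectral_norm A = onorm ((*v) A)"

text \<open>
  Square roots of the eigenvalues of \<open>A\<^sup>T A\<close>. If \<open>A\<close> has more columns than rows this set may contain
  a \<open>0\<close> that the \<open>min m n\<close> convention leaves out; for nonzero \<open>A\<close> neither the largest nor the
  smallest nonzero singular value depends on it.
\<close>

definition singular_values :: "real^'n^'m \<Rightarrow> real set"
  where "singular_values A =
    {sqrt \<mu> | \<mu>. \<exists>v. v \<noteq> 0 \<and> (transpose A ** A) *v v = \<mu> *\<^sub>R v}"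

definition sigma_max :: "real^'n^'m \<Rightarrow> real"
  where "sigma_max A = Max (singular_values A)"

definition sigma_min :: "real^'n^'m \<Rightarrow> real"
  where "sigma_min A = Min (singular_values A - {0})"

definition is_pseudoinverse :: "real^'n^'m \<Rightarrow> real^'m^'n \<Rightarrow> bool"
  where "is_pseudoinverse A X \<longleftrightarrow>
    A ** X ** A = A \<and> X ** A ** X = X \<and>
    transpose (A ** X) = A ** X \<and> transpose (X ** A) = X ** A"

definition pseudoinverse :: "real^'n^'m \<Rightarrow> real^'m^'n"
  where "pseudoinverse A = (THE X. is_pseudoinverse A X)"

text \<open>
  The number \<open>s\<close> of columns of the sketching matrices \<open>T\<^sub>1, T\<^sub>2\<close> is itself random, so it cannot be a
  type. An \<open>n \<times> s\<close> matrix is represented by the list of its \<open>s\<close> columns; the type of lists is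
  then the disjoint union of the spaces of \<open>n \<times> s\<close> matrices over all \<open>s\<close>. It carries the disjoint
  union of the Borel \<open>\<sigma>\<close>-algebras, obtained here by pulling back along the injection that
  sends a matrix to its number of columns and its columns padded by \<open>0\<close>.
\<close>

type_synonym 'n colmat = "(real^'n) list"

definition colmat_space :: "'n::finite colmat measure"
  where "colmat_space = vimage_algebra UNIV
    (\<lambda>T. (length T, \<lambda>j. if j < length T then T ! j else 0))
    (count_space UNIV \<Otimes>\<^sub>M (\<Pi>\<^sub>M j\<in>(UNIV :: nat set). borel))"

text \<open>The product \<open>T U\<^sup>T\<close> of \<open>n \<times> s\<close> matrices; used only when both have the same number of columns.\<close>

definition times_transpose :: "'n::finite colmat \<Rightarrow> 'n colmat \<Rightarrow> real^'n^'n"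
  where "times_transpose T U = (\<chi> i k. \<Sum>j<length T. (T ! j) $ i * (U ! j) $ k)"

text \<open>Quadruples \<open>(S\<^sub>1, S\<^sub>2, T\<^sub>1, T\<^sub>2)\<close>.\<close>

type_synonym ('m, 'n) quadruple = "(real^'m^'m) \<times> (real^'m^'m) \<times> 'n colmat \<times> 'n colmat"

definition quadruple_space :: "('m::finite, 'n::finite) quadruple measure"
  where "quadruple_space = borel \<Otimes>\<^sub>M borel \<Otimes>\<^sub>M colmat_space \<Otimes>\<^sub>M colmat_space"

text \<open>The matrix \<open>T\<^sub>1 T\<^sub>2\<^sup>T A\<^sup>T S\<^sub>1 S\<^sub>2\<^sup>T\<close>.\<close>

definition sketch_matrix :: "real^'n^'m \<Rightarrow> ('m::finite, 'n::finite) quadruple \<Rightarrow> real^'m^'n"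
  where "sketch_matrix A = (\<lambda>(S1, S2, T1, T2).
    times_transpose T1 T2 ** transpose A ** S1 ** transpose S2)"

text \<open>The matrix \<open>T\<^sub>2 T\<^sub>1\<^sup>T A\<^sup>T A T\<^sub>1 T\<^sub>2\<^sup>T\<close>.\<close>

definition gram_matrix :: "real^'n^'m \<Rightarrow> ('m::finite, 'n::finite) quadruple \<Rightarrow> real^'n^'n"
  where "gram_matrix A = (\<lambda>(S1, S2, T1, T2).
    times_transpose T2 T1 ** transpose A ** A ** times_transpose T1 T2)"

end

theory Submission
  imports Defs
begin

text \<open>
  Put \<open>e\<^sub>k = r\<^sup>k - r\<^sup>* = A (x\<^sup>k - x\<^sub>L\<^sub>S)\<close>. The normal equation turns the gradient term
  \<open>A\<^sup>T (A x\<^sup>k - b)\<close> into \<open>A\<^sup>T e\<^sub>k\<close>. Expanding \<open>|e\<^sub>k\<^sub>+\<^sub>1|\<^sup>2\<close> and averaging over the fresh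
  sample, which is independent of \<open>e\<^sub>k\<close> and \<open>e\<^sub>k\<^sub>-\<^sub>1\<close>, the mean of the sketch controls the linear term
  and \<open>\<beta>\<^sub>2\<close> the quadratic one. Since \<open>e\<^sub>k\<close> lies in the range of \<open>A\<close>,
  \<open>\<sigma>\<^sub>m\<^sub>i\<^sub>n |e\<^sub>k| \<le> |A\<^sup>T e\<^sub>k| \<le> \<sigma>\<^sub>m\<^sub>a\<^sub>x |e\<^sub>k|\<close>, which gives
  \<open>E |e\<^sub>k\<^sub>+\<^sub>1|\<^sup>2 \<le> \<gamma>\<^sub>1 E |e\<^sub>k|\<^sup>2 + \<gamma>\<^sub>2 E |e\<^sub>k\<^sub>-\<^sub>1|\<^sup>2\<close>. As \<open>q\<close> is the positive root of
  \<open>q\<^sup>2 = \<gamma>\<^sub>1 q + \<gamma>\<^sub>2\<close>, the quantity \<open>E |e\<^sub>k\<^sub>+\<^sub>1|\<^sup>2 + \<tau> E |e\<^sub>k|\<^sup>2\<close> contracts by the factor \<open>q\<close>.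
\<close>

subsection \<open>Pseudoinverse\<close>

lemma inner_matrix_vector_mult:
  fixes A :: "real^'n^'m"
  shows "x \<bullet> (A *v y) = (transpose A *v x) \<bullet> y"
  by (simp add: dot_lmul_matrix)

lemma norm_matrix_vector_mult_eq_inner:
  fixes A :: "real^'n^'m"
  shows "(norm (A *v x))\<^sup>2 = x \<bullet> ((transpose A ** A) *v x)"
  by (metis inner_commute inner_matrix_vector_mult matrix_vector_mul_assoc power2_norm_eq_inner)

lemma gram_matrix_vector_eq_0D:
  fixes A :: "real^'n^'m"
  assumes "transpose A *v (A *v x) = 0"
  shows "A *v x = 0"
  using norm_matrix_vector_mult_eq_inner[of A x] assms by (simp add: matrix_vector_mul_assoc)

text \<open>Orthogonal projection of \<open>b\<close> onto the range of \<open>A\<close> gives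
  \<open>A *v u\<close>; the remainder is orthogonal to that range, so \<open>transpose A\<close>
  annihilates it.\<close>

lemma normal_equation_solvable:
  fixes A :: "real^'n^'m"
  shows "\<exists>y. transpose A *v (A *v y) = transpose A *v b"
proof -
  obtain y z where y: "y \<in> span (range ((*v) A))"
    and z: "\<And>w. w \<in> span (range ((*v) A)) \<Longrightarrow> orthogonal z w" and b: "b = y + z"
    using orthogonal_subspace_decomp_exists[of "range ((*v) A)" b] by metis
  have "span (range ((*v) A)) = range ((*v) A)"
    by (metis span_eq_iff linear_subspace_image matrix_vector_mul_linear subspace_UNIV)
  then obtain u where u: "y = A *v u" using y by blast
  have "(transpose A *v z) \<bullet> w = 0" for w
    using z[of "A *v w"] by (simp add: orthogonal_def span_base inner_matrix_vector_mult)
  then have "transpose A *v z = 0" by (metis inner_eq_zero_iff)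
  then have "transpose A *v (A *v u) = transpose A *v b"
    by (simp add: b u matrix_vector_right_distrib)
  then show ?thesis ..
qed

text \<open>Least-squares solutions for the unit vectors, taken as the columns of \<open>Y\<close>,
  give A^T A Y = A^T. Multiplying by Y^T from the left yields (A Y)^T (A Y) = (A Y)^T, which forces
  A Y to be symmetric; transposing the first identity then gives A Y A = A.\<close>

lemma ex_symmetric_inner_inverse:
  fixes A :: "real^'n^'m"
  shows "\<exists>Y. A ** Y ** A = A \<and> transpose (A ** Y) = A ** Y"
proof -
  obtain y where y: "\<And>b. transpose A *v (A *v y b) = transpose A *v b"
    using normal_equation_solvable[of A] by metis
  define Y :: "real^'m^'n" where "Y = (\<chi> i j. y (axis j 1) $ i)"
  have col: "Y *v axis j 1 = y (axis j 1)" for j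
    by (simp add: matrix_vector_mult_basis column_def Y_def vec_eq_iff)
  have "(transpose A ** (A ** Y)) *v axis j 1 = transpose A *v axis j 1" for j
    using y by (simp add: matrix_vector_mul_assoc[symmetric] col)
  then have normal: "transpose A ** (A ** Y) = transpose A"
    by (simp add: matrix_vector_mult_basis column_def vec_eq_iff)
  have "transpose (A ** Y) ** (A ** Y) = transpose Y ** (transpose A ** (A ** Y))"
    by (simp add: matrix_transpose_mul matrix_mul_assoc)
  then have sym: "transpose (A ** Y) ** (A ** Y) = transpose (A ** Y)"
    by (simp add: normal matrix_transpose_mul)
  then have sym': "transpose (A ** Y) = A ** Y"
    by (metis matrix_transpose_mul transpose_transpose)
  have "A ** Y ** A = transpose (transpose A ** transpose (A ** Y))"
    by (simp only: matrix_transpose_mul transpose_transpose)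
  also have "\<dots> = A" by (simp only: sym' normal transpose_transpose)
  finally show ?thesis using sym' by blast
qed

text \<open>Urquhart's construction: \<open>Y\<close> is a (1,3)-inverse of \<open>A\<close>, the
  transpose \<open>W\<close> of a (1,3)-inverse of A^T is a (1,4)-inverse of \<open>A\<close>, and W
  A Y satisfies all four Penrose equations.\<close>

lemma is_pseudoinverse_exists:
  fixes A :: "real^'n^'m"
  shows "\<exists>X. is_pseudoinverse A X"
proof -
  obtain Y where Y: "A ** Y ** A = A" "transpose (A ** Y) = A ** Y"
    using ex_symmetric_inner_inverse by blast
  obtain Z where Z: "transpose A ** Z ** transpose A = transpose A"
    "transpose (transpose A ** Z) = transpose A ** Z"
    using ex_symmetric_inner_inverse by blast
  define W where "W = transpose Z"
  have W: "A ** W ** A = A" "transpose (W ** A) = W ** A"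
    using Z unfolding W_def
    by (metis matrix_mul_assoc matrix_transpose_mul transpose_transpose)+
  have "A ** (W ** A ** Y) = A ** Y" "(W ** A ** Y) ** A = W ** A"
    using W(1) Y(1) by (metis matrix_mul_assoc)+
  moreover have "W ** A ** W ** A ** Y = W ** A ** Y"
    using W(1) by (metis matrix_mul_assoc)
  ultimately have "is_pseudoinverse A (W ** A ** Y)"
    unfolding is_pseudoinverse_def using W Y by (simp add: matrix_mul_assoc)
  then show ?thesis ..
qed

text \<open>A X and A Y are symmetric projections that absorb each other, so transposing one
  absorption identity equates them; likewise X A = Y A. Then X = X A X = X A Y = Y A Y = Y.\<close>

lemma is_pseudoinverse_unique:
  fixes A :: "real^'n^'m"
  assumes X: "is_pseudoinverse A X" and Y: "is_pseudoinverse A Y"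
  shows "X = Y"
proof -
  note X = X[unfolded is_pseudoinverse_def] and Y = Y[unfolded is_pseudoinverse_def]
  have "A ** X = (A ** Y) ** (A ** X)" "X ** A = (X ** A) ** (Y ** A)"
    using Y by (simp_all add: matrix_mul_assoc)
      (metis matrix_mul_assoc)
  moreover have "(A ** X) ** (A ** Y) = A ** Y" "(Y ** A) ** (X ** A) = Y ** A"
    using X by (simp_all add: matrix_mul_assoc)
      (metis matrix_mul_assoc)
  ultimately have "A ** X = A ** Y" "X ** A = Y ** A"
    using X Y by (metis matrix_transpose_mul)+
  then show ?thesis using X Y by (metis matrix_mul_assoc)
qed

lemma is_pseudoinverse_pseudoinverse: "is_pseudoinverse A (pseudoinverse A)"
  unfolding pseudoinverse_def
  using is_pseudoinverse_exists is_pseudoinverse_unique by (metis theI)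

lemma pseudoinverse_normal_equation:
  "transpose A *v (A *v (pseudoinverse A *v b)) = transpose A *v b"
proof -
  have "transpose A ** (A ** pseudoinverse A) = transpose A"
    using is_pseudoinverse_pseudoinverse[of A] unfolding is_pseudoinverse_def
    by (metis matrix_transpose_mul)
  then show ?thesis by (simp add: matrix_vector_mul_assoc matrix_mul_assoc)
qed

subsection \<open>Extremal singular values\<close>

text \<open>The Rayleigh quotient attains its maximum on the compact unit sphere of
  \<open>V\<close>, and invariance of \<open>V\<close> keeps the eigenvalue residual
  \<open>w\<close> inside \<open>V\<close>, where maximality can be tested. Allowing a subspace
  makes it possible to exclude the kernel of a matrix later.\<close>

lemma self_adjoint_max_eigenvector:
  fixes f :: "'a::euclidean_space \<Rightarrow> 'a"
  assumes f: "linear f" and sym: "\<And>x y. f x \<bullet> y = x \<bullet> f y"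
    and V: "subspace V" "f ` V \<subseteq> V" and "w0 \<in> V" "w0 \<noteq> 0"
  obtains v \<mu> where "v \<in> V" "norm v = 1" "f v = \<mu> *\<^sub>R v"
    "\<And>x. x \<in> V \<Longrightarrow> x \<bullet> f x \<le> \<mu> * (norm x)\<^sup>2"
proof -
  have "compact (V \<inter> sphere 0 1)"
    using closed_subspace[OF V(1)] by (simp add: closed_Int_compact)
  moreover have "(1 / norm w0) *\<^sub>R w0 \<in> V \<inter> sphere 0 1"
    using assms by (simp add: subspace_scale)
  then have "V \<inter> sphere 0 1 \<noteq> {}" by blast
  moreover have "continuous_on (V \<inter> sphere 0 1) (\<lambda>x. x \<bullet> f x)"
    using f by (intro continuous_intros linear_continuous_on linear_conv_bounded_linear[THEN iffD1])
  ultimately obtain v where v: "v \<in> V" "norm v = 1"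
    and max: "\<And>x. x \<in> V \<Longrightarrow> norm x = 1 \<Longrightarrow> x \<bullet> f x \<le> v \<bullet> f v"
    using continuous_attains_sup[of "V \<inter> sphere 0 1" "\<lambda>x. x \<bullet> f x"]
    by (metis IntE IntI dist_0_norm mem_sphere)
  define \<mu> where "\<mu> = v \<bullet> f v"
  have le: "x \<bullet> f x \<le> \<mu> * (norm x)\<^sup>2" if "x \<in> V" for x
  proof (cases "x = 0")
    case False
    then have "((1 / norm x) *\<^sub>R x) \<bullet> f ((1 / norm x) *\<^sub>R x) \<le> \<mu>"
      unfolding \<mu>_def using that V(1) by (intro max) (auto simp: subspace_scale)
    then show ?thesis
      using False f by (simp add: linear_cmul field_simps power2_eq_square)
  qed (simp add: linear_0[OF f])
  define w where "w = \<mu> *\<^sub>R v - f v"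
  define g where "g = \<mu> * (norm w)\<^sup>2 - w \<bullet> f w"
  have w: "w \<in> V" unfolding w_def using V v by (auto intro!: subspace_diff subspace_scale)
  have g: "g \<ge> 0" using le[OF w] by (simp add: g_def)
  \<comment> \<open>The form \<open>\<mu> |x|\<^sup>2 - x \<bullet> f x\<close> is nonnegative on \<open>V\<close> and vanishes at \<open>v\<close>; perturbing \<open>v\<close> in the
    direction \<open>-w\<close> would make it negative unless \<open>w = 0\<close>.\<close>
  have pert: "2 * t * (norm w)\<^sup>2 \<le> t\<^sup>2 * g" for t
  proof -
    have "v - t *\<^sub>R w \<in> V" using V v w by (auto intro!: subspace_diff subspace_scale)
    note le_pert = le[OF this]
    have vw: "v \<bullet> f w = f v \<bullet> w" "w \<bullet> f v = f v \<bullet> w"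
      by (simp add: sym, rule inner_commute)
    have form: "(v - t *\<^sub>R w) \<bullet> f (v - t *\<^sub>R w) = \<mu> - 2 * t * (f v \<bullet> w) + t\<^sup>2 * (w \<bullet> f w)"
      by (simp add: linear_diff[OF f] linear_cmul[OF f] inner_diff_left inner_diff_right vw
          \<mu>_def power2_eq_square algebra_simps)
    have norm: "(norm (v - t *\<^sub>R w))\<^sup>2 = 1 - 2 * t * (v \<bullet> w) + t\<^sup>2 * (norm w)\<^sup>2"
      using v(2) unfolding power2_norm_eq_inner norm_eq_1
      by (simp add: inner_diff_left inner_diff_right inner_commute[of w v]
          power2_eq_square algebra_simps)
    have "(norm w)\<^sup>2 = \<mu> * (v \<bullet> w) - f v \<bullet> w"
      unfolding power2_norm_eq_inner by (subst (1) w_def) (simp add: inner_diff_left)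
    then have "2 * t * (norm w)\<^sup>2 = 2 * t * (\<mu> * (v \<bullet> w)) - 2 * t * (f v \<bullet> w)"
      by (simp only: right_diff_distrib)
    then show ?thesis
      using le_pert unfolding form norm g_def by (simp add: algebra_simps)
  qed
  \<comment> \<open>This choice makes |w|^2 = t (g + 1), so \<open>pert\<close> collapses to t^2 (g
    + 2) \<le> 0; the added 1 keeps the denominator positive when \<open>g = 0\<close>.\<close>
  define t where "t = (norm w)\<^sup>2 / (g + 1)"
  have t: "(norm w)\<^sup>2 = t * (g + 1)" using g by (simp add: t_def)
  have "2 * t * (t * (g + 1)) \<le> t\<^sup>2 * g" using pert[of t] unfolding t .
  then have "t\<^sup>2 * (g + 2) \<le> 0" by (simp add: power2_eq_square algebra_simps)
  then have "t = 0" using g by (simp add: mult_le_0_iff)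
  then have "w = 0" using t by simp
  then show ?thesis using that[of v \<mu>] v le by (simp add: w_def)
qed

lemma gram_eigenvalue_nonneg:
  fixes A :: "real^'n^'m"
  assumes "v \<noteq> 0" "(transpose A ** A) *v v = \<mu> *\<^sub>R v"
  shows "\<mu> \<ge> 0"
proof -
  have "(norm (A *v v))\<^sup>2 = \<mu> * (norm v)\<^sup>2"
    by (simp add: norm_matrix_vector_mult_eq_inner assms) (simp add: power2_norm_eq_inner)
  then show ?thesis using assms(1)
    by (metis zero_le_mult_iff zero_le_power2 norm_eq_zero not_less power_eq_0_iff order_antisym)
qed

lemma gram_self_adjoint:
  fixes A :: "real^'n^'m"
  shows "((transpose A ** A) *v x) \<bullet> y = x \<bullet> ((transpose A ** A) *v y)"
  by (simp add: inner_matrix_vector_mult matrix_transpose_mul)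

text \<open>Makes \<open>Max\<close> and \<open>Min\<close> over \<open>singular_values\<close>
  meaningful. Eigenvectors of the symmetric matrix A^T A for distinct eigenvalues are orthogonal,
  hence independent, and there are only finitely many independent vectors.\<close>

lemma finite_singular_values:
  fixes A :: "real^'n^'m"
  shows "finite (singular_values A)"
proof -
  define E where "E = {\<mu>. \<exists>v. v \<noteq> 0 \<and> (transpose A ** A) *v v = \<mu> *\<^sub>R v}"
  have "\<forall>\<mu>\<in>E. \<exists>v. v \<noteq> 0 \<and> (transpose A ** A) *v v = \<mu> *\<^sub>R v"
    by (simp add: E_def)
  then obtain u where u: "\<And>\<mu>. \<mu> \<in> E \<Longrightarrow> u \<mu> \<noteq> 0 \<and> (transpose A ** A) *v u \<mu> = \<mu> *\<^sub>R u \<mu>"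
    by (auto dest!: bchoice)
  have orth: "u \<mu> \<bullet> u \<nu> = 0" if "\<mu> \<in> E" "\<nu> \<in> E" "\<mu> \<noteq> \<nu>" for \<mu> \<nu>
    using gram_self_adjoint[of A "u \<mu>" "u \<nu>"] u that by simp
  then have inj: "inj_on u E" using u by (intro inj_onI) (metis inner_eq_zero_iff)
  have "pairwise orthogonal (u ` E)"
    using orth by (auto simp: pairwise_def orthogonal_def)
  moreover have "0 \<notin> u ` E" using u by force
  ultimately have "finite (u ` E)"
    by (intro independent_bound[THEN conjunct1] pairwise_orthogonal_independent)
  then have "finite E" using inj finite_imageD by blast
  moreover have "singular_values A = sqrt ` E" by (auto simp: singular_values_def E_def)
  ultimately show ?thesis by simp
qed

text \<open>The largest eigenvalue of A^T A bounds its Rayleigh quotient, and the square root of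
  that eigenvalue is one of the singular values.\<close>

lemma norm_matrix_vector_mult_le_sigma_max:
  fixes A :: "real^'n^'m"
  shows "(norm (A *v x))\<^sup>2 \<le> (sigma_max A)\<^sup>2 * (norm x)\<^sup>2"
proof -
  \<comment> \<open>The whole space is the invariant subspace; \<open>axis undefined 1\<close>
    serves as some nonzero vector in it.\<close>
  obtain v \<mu> where v: "norm v = 1" "(transpose A ** A) *v v = \<mu> *\<^sub>R v"
    and le: "\<And>x. x \<bullet> ((transpose A ** A) *v x) \<le> \<mu> * (norm x)\<^sup>2"
    using self_adjoint_max_eigenvector[of "(*v) (transpose A ** A)" UNIV "axis undefined 1"]
    by (auto simp: gram_self_adjoint)
  have "\<mu> \<ge> 0" using gram_eigenvalue_nonneg v by (metis norm_zero zero_neq_one)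
  have "sqrt \<mu> \<in> singular_values A"
    unfolding singular_values_def using v by (auto intro!: exI[of _ \<mu>] exI[of _ v])
  then have "sqrt \<mu> \<le> sigma_max A"
    unfolding sigma_max_def by (intro Max_ge finite_singular_values)
  with \<open>\<mu> \<ge> 0\<close> have "\<mu> \<le> (sigma_max A)\<^sup>2" by (simp add: sqrt_le_D)
  then show ?thesis
    using le[of x] by (simp add: norm_matrix_vector_mult_eq_inner)
      (meson mult_right_mono order_trans zero_le_power2)
qed

text \<open>The spectra of A A^T and A^T A need not be compared: for u = A^T y, Cauchy-Schwarz
  bounds |u|^2 = y . (A u) by |y| |A u|, and after squaring and using the bound for \<open>A\<close>
  a factor |u|^2 cancels.\<close>

lemma norm_transpose_vector_mult_le_sigma_max:
  fixes A :: "real^'n^'m"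
  shows "(norm (transpose A *v y))\<^sup>2 \<le> (sigma_max A)\<^sup>2 * (norm y)\<^sup>2"
proof -
  define u where "u = transpose A *v y"
  have "(norm u)\<^sup>2 = y \<bullet> (A *v u)"
    by (simp add: inner_matrix_vector_mult u_def power2_norm_eq_inner)
  also have "\<dots> \<le> norm y * norm (A *v u)" by (rule norm_cauchy_schwarz)
  finally have "((norm u)\<^sup>2)\<^sup>2 \<le> (norm y)\<^sup>2 * (norm (A *v u))\<^sup>2"
    by (metis power_mono power_mult_distrib zero_le_power2)
  also have "\<dots> \<le> (norm y)\<^sup>2 * ((sigma_max A)\<^sup>2 * (norm u)\<^sup>2)"
    by (intro mult_left_mono norm_matrix_vector_mult_le_sigma_max) simp
  finally have "(norm u)\<^sup>2 * (norm u)\<^sup>2 \<le> (norm u)\<^sup>2 * ((sigma_max A)\<^sup>2 * (norm y)\<^sup>2)"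
    by (simp add: power2_eq_square algebra_simps)
  then have "u \<noteq> 0 \<Longrightarrow> (norm u)\<^sup>2 \<le> (sigma_max A)\<^sup>2 * (norm y)\<^sup>2"
    by (subst (asm) mult_le_cancel_left_pos) auto
  then show ?thesis unfolding u_def[symmetric] by (cases "u = 0") auto
qed

text \<open>To avoid the kernel of \<open>A\<close>, the smallest eigenvalue of A^T A is taken on
  the row space \<open>V\<close>. There it is positive, so its root is a nonzero singular value, and
  every \<open>A *v x\<close> is already the image of a row-space vector.\<close>

lemma norm_transpose_vector_mult_ge_sigma_min:
  fixes A :: "real^'n^'m"
  assumes "A \<noteq> 0"
  shows "(sigma_min A)\<^sup>2 * (norm (A *v x))\<^sup>2 \<le> (norm (transpose A *v (A *v x)))\<^sup>2"
proof -
  define V where "V = range ((*v) (transpose A))"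
  have V: "subspace V"
    unfolding V_def by (intro linear_subspace_image matrix_vector_mul_linear subspace_UNIV)
  have "transpose A \<noteq> 0" using assms by (auto simp: vec_eq_iff transpose_def)
  then obtain y where y: "transpose A *v y \<noteq> 0"
    by (metis matrix_eq matrix_vector_mult_0)
  \<comment> \<open>Negating A^T A turns the maximal eigenvector on \<open>V\<close> into a minimal
    one.\<close>
  have lin: "linear (\<lambda>x. - ((transpose A ** A) *v x))"
    by (intro linear_compose_neg matrix_vector_mul_linear)
  have inv: "(\<lambda>x. - ((transpose A ** A) *v x)) ` V \<subseteq> V"
    using V by (auto simp: V_def matrix_vector_mul_assoc[symmetric] intro!: subspace_neg)
  obtain v \<nu> where v: "v \<in> V" "norm v = 1" "- ((transpose A ** A) *v v) = \<nu> *\<^sub>R v"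
    and le: "\<And>x. x \<in> V \<Longrightarrow> - (x \<bullet> ((transpose A ** A) *v x)) \<le> \<nu> * (norm x)\<^sup>2"
    using self_adjoint_max_eigenvector[OF lin _ V inv, of "transpose A *v y"] y
    by (auto simp: gram_self_adjoint V_def)
  define \<mu> where "\<mu> = - \<nu>"
  have eig: "(transpose A ** A) *v v = \<mu> *\<^sub>R v"
    using v(3) by (simp add: \<mu>_def minus_equation_iff)
  have v0: "v \<noteq> 0" using v(2) by auto
  have ge: "\<mu> * (norm x)\<^sup>2 \<le> (norm (A *v x))\<^sup>2" if "x \<in> V" for x
    using le[OF that] by (simp add: norm_matrix_vector_mult_eq_inner \<mu>_def)
  \<comment> \<open>Otherwise \<open>v\<close> would lie both in the kernel of \<open>A\<close> and
    in the row space, which are orthogonal.\<close>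
  have "\<mu> \<noteq> 0"
  proof
    assume "\<mu> = 0"
    then have "transpose A *v (A *v v) = 0"
      using eig by (simp only: matrix_vector_mul_assoc scaleR_zero_left)
    then have "A *v v = 0" by (rule gram_matrix_vector_eq_0D)
    moreover obtain z where "v = transpose A *v z" using v(1) by (auto simp: V_def)
    ultimately have "v \<bullet> v = 0" by (metis inner_matrix_vector_mult inner_zero_right)
    then show False using v0 by simp
  qed
  then have in_sv: "sqrt \<mu> \<in> singular_values A - {0}"
    unfolding singular_values_def using v0 eig by (auto intro!: exI[of _ \<mu>] exI[of _ v])
  have "sigma_min A \<le> sqrt \<mu>"
    unfolding sigma_min_def using in_sv finite_singular_values by (intro Min_le) auto
  moreover have "sigma_min A \<in> singular_values A"
    unfolding sigma_min_def using in_sv finite_singular_values Min_in[of "singular_values A - {0}"]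
    by blast
  then have "sigma_min A \<ge> 0"
    using gram_eigenvalue_nonneg[of _ A] by (auto simp: singular_values_def)
  ultimately have s: "(sigma_min A)\<^sup>2 \<le> \<mu>"
    by (metis power_mono real_sqrt_pow2 gram_eigenvalue_nonneg[OF v0 eig])
  \<comment> \<open>Only the row-space part \<open>p\<close> of \<open>x\<close> survives under
    \<open>A\<close>; the orthogonal remainder \<open>k\<close> lies in the kernel.\<close>
  obtain p k where p: "p \<in> span V" and k: "\<And>w. w \<in> span V \<Longrightarrow> orthogonal k w" and x: "x = p + k"
    using orthogonal_subspace_decomp_exists[of V x] by metis
  have pV: "p \<in> V" using p V by (simp add: span_eq_iff[THEN iffD2])
  have "k \<bullet> (transpose A *v (A *v k)) = 0"
    using k[of "transpose A *v (A *v k)"] by (simp add: orthogonal_def V_def span_base)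
  then have "A *v k = 0"
    using norm_matrix_vector_mult_eq_inner[of A k] by (simp add: matrix_vector_mul_assoc)
  then have e: "A *v x = A *v p" by (simp add: x matrix_vector_right_distrib)
  define e where "e = A *v p"
  have "(norm e)\<^sup>2 = (transpose A *v e) \<bullet> p"
    by (simp add: e_def power2_norm_eq_inner inner_matrix_vector_mult)
  also have "\<dots> \<le> norm (transpose A *v e) * norm p" by (rule norm_cauchy_schwarz)
  finally have "((norm e)\<^sup>2)\<^sup>2 \<le> (norm (transpose A *v e))\<^sup>2 * (norm p)\<^sup>2"
    by (metis power_mono power_mult_distrib zero_le_power2)
  \<comment> \<open>The bound \<open>ge\<close> trades \<mu> |p|^2 for |e|^2, after which a factor
    |e|^2 cancels.\<close>
  then have "\<mu> * ((norm e)\<^sup>2)\<^sup>2 \<le> \<mu> * ((norm (transpose A *v e))\<^sup>2 * (norm p)\<^sup>2)"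
    by (intro mult_left_mono gram_eigenvalue_nonneg[OF v0 eig])
  also have "\<dots> \<le> (norm (transpose A *v e))\<^sup>2 * (norm e)\<^sup>2"
    using mult_left_mono[OF ge[OF pV], of "(norm (transpose A *v e))\<^sup>2"]
    by (simp add: e_def algebra_simps)
  finally have "(norm e)\<^sup>2 * (\<mu> * (norm e)\<^sup>2) \<le> (norm e)\<^sup>2 * (norm (transpose A *v e))\<^sup>2"
    by (simp add: power2_eq_square algebra_simps)
  then have "\<mu> * (norm e)\<^sup>2 \<le> (norm (transpose A *v e))\<^sup>2"
    by (cases "e = 0") auto
  then show ?thesis unfolding e e_def[symmetric]
    using s by (meson mult_right_mono order_trans zero_le_power2)
qed

subsection \<open>One step of the iteration\<close>

lemma inner_matrix_le_spectral_norm: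
  fixes G :: "real^'n^'n"
  shows "x \<bullet> (G *v x) \<le> spectral_norm G * (norm x)\<^sup>2"
proof -
  have "x \<bullet> (G *v x) \<le> norm x * norm (G *v x)" by (rule norm_cauchy_schwarz)
  also have "\<dots> \<le> norm x * (spectral_norm G * norm x)"
    unfolding spectral_norm_def by (intro mult_left_mono onorm) auto
  finally show ?thesis by (simp add: power2_eq_square algebra_simps)
qed

lemma frobenius_norm_eq_0_iff: "frobenius_norm A = 0 \<longleftrightarrow> A = 0"
  by (simp add: frobenius_norm_def real_sqrt_eq_zero_cancel_iff sum_nonneg_eq_0_iff sum_nonneg vec_eq_iff)

text \<open>\<open>times_transpose\<close> sums over the length of its first argument, so equal
  lengths are what give both products the same index range.\<close>

lemma times_transpose_swap:
  "length T = length U \<Longrightarrow> times_transpose U T = transpose (times_transpose T U)"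
  by (simp add: times_transpose_def transpose_def vec_eq_iff mult.commute)

lemma bounded_linear_matrix_vector_mult_left: "bounded_linear (\<lambda>X :: real^'n^'m. X *v v)"
  by (intro linear_conv_bounded_linear[THEN iffD1] linearI)
     (simp_all add: matrix_vector_mult_add_rdistrib scaleR_matrix_vector_assoc)

text \<open>Links the second moment of the step to \<beta>2. S1 S2^T collapses to \<rho> I, which
  enters squared, and T2 T1^T A^T A T1 T2^T is the Gram matrix of A T1 T2^T.\<close>

lemma norm_sketch_eq_gram:
  fixes A :: "real^'n^'m"
  assumes "length T1 = length T2" "\<rho> \<ge> 0"
    and "S1 = sqrt \<rho> *\<^sub>R mat 1" "S2 = sqrt \<rho> *\<^sub>R mat 1"
  shows "(norm (A *v (sketch_matrix A (S1, S2, T1, T2) *v u)))\<^sup>2 =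
    \<rho>\<^sup>2 * ((transpose A *v u) \<bullet> (gram_matrix A (S1, S2, T1, T2) *v (transpose A *v u)))"
proof -
  define H where "H = times_transpose T1 T2"
  define w where "w = transpose A *v u"
  have "sketch_matrix A (S1, S2, T1, T2) = \<rho> *\<^sub>R (H ** transpose A)"
    using assms
    by (simp add: sketch_matrix_def H_def transpose_scalar matrix_scalar_ac
        scalar_matrix_assoc[symmetric])
  then have "A *v (sketch_matrix A (S1, S2, T1, T2) *v u) = \<rho> *\<^sub>R ((A ** H) *v w)"
    by (simp add: w_def scaleR_matrix_vector_assoc[symmetric] matrix_vector_mult_scaleR
        matrix_vector_mul_assoc matrix_mul_assoc del: transpose_matrix_vector)
  moreover have "gram_matrix A (S1, S2, T1, T2) = transpose (A ** H) ** (A ** H)"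
    by (simp add: gram_matrix_def H_def times_transpose_swap[OF assms(1)] matrix_transpose_mul
        matrix_mul_assoc)
  ultimately show ?thesis
    by (simp add: w_def[symmetric] power_mult_distrib norm_matrix_vector_mult_eq_inner
        del: transpose_matrix_vector)
qed

lemma (in prob_space) norm_diff_power2_expectation:
  fixes s :: "'a \<Rightarrow> 'b::euclidean_space"
  assumes s: "integrable M s" and s2: "integrable M (\<lambda>z. (norm (s z))\<^sup>2)"
  shows "integrable M (\<lambda>z. (norm (c - s z))\<^sup>2)"
    and "(\<integral>z. (norm (c - s z))\<^sup>2 \<partial>M) = (norm c)\<^sup>2 - 2 * (c \<bullet> (\<integral>z. s z \<partial>M)) + (\<integral>z. (norm (s z))\<^sup>2 \<partial>M)"
proof -
  have eq: "(norm (c - s z))\<^sup>2 = (norm c)\<^sup>2 - 2 * (c \<bullet> s z) + (norm (s z))\<^sup>2" for z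
    by (simp add: power2_norm_eq_inner inner_diff_left inner_diff_right inner_commute)
  show "integrable M (\<lambda>z. (norm (c - s z))\<^sup>2)"
    unfolding eq using s s2 by auto
  show "(\<integral>z. (norm (c - s z))\<^sup>2 \<partial>M) = (norm c)\<^sup>2 - 2 * (c \<bullet> (\<integral>z. s z \<partial>M)) + (\<integral>z. (norm (s z))\<^sup>2 \<partial>M)"
    unfolding eq using s s2 by (simp add: prob_space)
qed

text \<open>The right side exceeds the left by exactly (\<omega> + \<omega>^2) |e + d|^2.\<close>

lemma momentum_norm_le:
  fixes e d :: "'a::real_inner"
  assumes "\<omega> \<ge> 0"
  shows "(norm (e + \<omega> *\<^sub>R (e - d)))\<^sup>2 \<le>
    (1 + 3 * \<omega> + 2 * \<omega>\<^sup>2) * (norm e)\<^sup>2 + (2 * \<omega>\<^sup>2 + \<omega>) * (norm d)\<^sup>2"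
proof -
  have "0 \<le> \<omega> * (norm (e + d))\<^sup>2 + \<omega>\<^sup>2 * (norm (e + d))\<^sup>2"
    using assms by simp
  then show ?thesis
    unfolding power2_norm_eq_inner
    by (simp add: inner_add_left inner_add_right inner_diff_left inner_diff_right inner_commute
        power2_eq_square[of \<omega>] algebra_simps)
qed

text \<open>After \<open>A\<close> is moved to the other factor, polarizing 2 (u - v) . u shows that
  the sides differ by \<omega> |u - v|^2.\<close>

lemma momentum_gradient_inner_ge:
  fixes A :: "real^'n^'m"
  assumes "\<omega> \<ge> 0"
  shows "2 * ((e + \<omega> *\<^sub>R (e - d)) \<bullet> (A *v (transpose A *v e))) \<ge>
    (2 + \<omega>) * (norm (transpose A *v e))\<^sup>2 - \<omega> * (norm (transpose A *v d))\<^sup>2"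
proof -
  define u v where "u = transpose A *v e" and "v = transpose A *v d"
  have "transpose A *v (e + \<omega> *\<^sub>R (e - d)) = u + \<omega> *\<^sub>R (u - v)"
    by (simp add: u_def v_def matrix_vector_right_distrib matrix_vector_mult_scaleR
        matrix_vector_mult_diff_distrib)
  then have "2 * ((e + \<omega> *\<^sub>R (e - d)) \<bullet> (A *v u)) = 2 * ((u + \<omega> *\<^sub>R (u - v)) \<bullet> u)"
    by (simp only: inner_matrix_vector_mult)
  also have "\<dots> = (2 + \<omega>) * (norm u)\<^sup>2 - \<omega> * (norm v)\<^sup>2 + \<omega> * (norm (u - v))\<^sup>2"
    by (simp add: power2_norm_eq_inner inner_add_left inner_diff_left inner_diff_right
        inner_commute algebra_simps)
  finally show ?thesis using assms by (simp add: u_def v_def)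
qed

text \<open>The state pairs the current iterate with the previous one, which makes the momentum
  recursion first order.\<close>

definition mpfr_step ::
    "real^'n^'m \<Rightarrow> real^'m \<Rightarrow> real \<Rightarrow> real \<Rightarrow> (real^'n) \<times> (real^'n) \<Rightarrow> ('m, 'n) quadruple \<Rightarrow> real^'n"
  where "mpfr_step A b \<alpha> \<omega> = (\<lambda>(x, y) z.
    x - \<alpha> *\<^sub>R (sketch_matrix A z *v (A *v x - b)) + \<omega> *\<^sub>R (x - y))"

text \<open>The conditional form of the recursion: the state \<open>(x, y)\<close> is fixed and only
  the fresh sample is integrated.\<close>

lemma mpfr_step_residual_contraction:
  fixes A :: "real^'n^'m" and D :: "('m, 'n) quadruple measure"
  assumes A: "A \<noteq> 0" and \<rho>: "\<rho> > 0" and D: "prob_space D"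
    and width: "AE (S1, S2, T1, T2) in D. length T1 = length T2"
    and S: "AE (S1, S2, T1, T2) in D. S1 = sqrt \<rho> *\<^sub>R mat 1 \<and> S2 = sqrt \<rho> *\<^sub>R mat 1"
    and sk: "integrable D (sketch_matrix A)"
    and mean: "(\<integral>z. sketch_matrix A z \<partial>D) = (1 / (frobenius_norm A)\<^sup>2) *\<^sub>R transpose A"
    and gram: "integrable D (gram_matrix A)"
    and \<beta>2: "\<beta>2 = spectral_norm (\<integral>z. gram_matrix A z \<partial>D)"
    and \<alpha>: "0 < \<alpha>" "\<alpha> < 2 / (\<rho>\<^sup>2 * \<beta>2 * (frobenius_norm A)\<^sup>2)"
    and \<omega>: "\<omega> \<ge> 0"
    and \<gamma>1: "\<gamma>1 = 1 + 3 * \<omega> + 2 * \<omega>\<^sup>2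
      - (2 * \<alpha> - \<alpha>\<^sup>2 * \<rho>\<^sup>2 * \<beta>2 * (frobenius_norm A)\<^sup>2 + \<alpha> * \<omega>)
        * ((sigma_min A)\<^sup>2 / (frobenius_norm A)\<^sup>2)"
    and \<gamma>2: "\<gamma>2 = 2 * \<omega>\<^sup>2 + \<omega> + \<omega> * \<alpha> * ((sigma_max A)\<^sup>2 / (frobenius_norm A)\<^sup>2)"
    and ls: "transpose A *v (A *v xs) = transpose A *v b"
  shows "integrable D (\<lambda>z. (norm (A *v mpfr_step A b \<alpha> \<omega> (x, y) z - A *v xs))\<^sup>2)" (is ?int)
    and "(\<integral>z. (norm (A *v mpfr_step A b \<alpha> \<omega> (x, y) z - A *v xs))\<^sup>2 \<partial>D)
      \<le> \<gamma>1 * (norm (A *v x - A *v xs))\<^sup>2 + \<gamma>2 * (norm (A *v y - A *v xs))\<^sup>2" (is ?le)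
proof -
  interpret D: prob_space D by (rule D)
  define F where "F = (frobenius_norm A)\<^sup>2"
  define e d where "e = A *v x - A *v xs" and "d = A *v y - A *v xs"
  define c where "c = e + \<omega> *\<^sub>R (e - d)"
  define s where "s = (\<lambda>z. A *v (sketch_matrix A z *v (A *v x - b)))"
  define w where "w = transpose A *v e"
  define G where "G = (\<integral>z. gram_matrix A z \<partial>D)"
  have F: "F > 0" using A by (simp add: F_def frobenius_norm_eq_0_iff)
  have w: "transpose A *v (A *v x - b) = w"
    by (simp add: w_def e_def matrix_vector_mult_diff_distrib ls del: transpose_matrix_vector)
  have step: "A *v mpfr_step A b \<alpha> \<omega> (x, y) z - A *v xs = c - \<alpha> *\<^sub>R s z" for z
    by (simp add: mpfr_step_def c_def e_def d_def s_def matrix_vector_right_distrib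
        matrix_vector_mult_diff_distrib matrix_vector_mult_scaleR)

  have lin: "bounded_linear (\<lambda>X :: real^'m^'n. A *v (X *v (A *v x - b)))"
    by (rule bounded_linear_compose[OF matrix_vector_mul_bounded_linear
          bounded_linear_matrix_vector_mult_left])
  have s: "integrable D s" unfolding s_def by (rule integrable_bounded_linear[OF lin sk])
  have "(\<integral>z. s z \<partial>D) = A *v ((\<integral>z. sketch_matrix A z \<partial>D) *v (A *v x - b))"
    unfolding s_def by (rule integral_bounded_linear[OF lin sk])
  then have s_mean: "(\<integral>z. s z \<partial>D) = (1 / F) *\<^sub>R (A *v w)"
    by (simp add: mean F_def[symmetric] scaleR_matrix_vector_assoc[symmetric] w
        matrix_vector_mult_scaleR del: transpose_matrix_vector)

  have lin': "bounded_linear (\<lambda>X :: real^'n^'n. w \<bullet> (X *v w))"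
    by (rule bounded_linear_compose[OF bounded_linear_inner_right
          bounded_linear_matrix_vector_mult_left])
  have norm_s: "AE z in D. \<rho>\<^sup>2 * (w \<bullet> (gram_matrix A z *v w)) = (norm (s z))\<^sup>2"
    using width S
  proof eventually_elim
    case (elim z)
    then show ?case
      using norm_sketch_eq_gram[where \<rho> = \<rho> and A = A and u = "A *v x - b", unfolded w] \<rho>
      by (cases z) (auto simp: s_def)
  qed
  \<comment> \<open>Integrability of |s|^2 is transferred from that of \<open>gram_matrix A\<close>
    along the almost sure identity \<open>norm_s\<close>.\<close>
  have gram_int: "integrable D (\<lambda>z. \<rho>\<^sup>2 * (w \<bullet> (gram_matrix A z *v w)))"
    by (intro integrable_mult_right integrable_bounded_linear[OF lin' gram])
  have s2_meas: "(\<lambda>z. (norm (s z))\<^sup>2) \<in> borel_measurable D" using s by measurable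
  have s2: "integrable D (\<lambda>z. (norm (s z))\<^sup>2)"
    by (rule integrable_cong_AE_imp[OF gram_int s2_meas norm_s])
  have "(\<integral>z. (norm (s z))\<^sup>2 \<partial>D) = (\<integral>z. \<rho>\<^sup>2 * (w \<bullet> (gram_matrix A z *v w)) \<partial>D)"
    using norm_s by (intro integral_cong_AE s2_meas borel_measurable_integrable[OF gram_int]) auto
  also have "\<dots> = \<rho>\<^sup>2 * (w \<bullet> (G *v w))"
    unfolding G_def using integral_bounded_linear[OF lin' gram] by simp
  also have "\<dots> \<le> \<rho>\<^sup>2 * (\<beta>2 * (norm w)\<^sup>2)"
    unfolding \<beta>2 G_def by (intro mult_left_mono inner_matrix_le_spectral_norm) auto
  finally have s2_le: "(\<integral>z. (norm (s z))\<^sup>2 \<partial>D) \<le> \<rho>\<^sup>2 * \<beta>2 * (norm w)\<^sup>2"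
    by (simp add: algebra_simps)

  have as: "integrable D (\<lambda>z. \<alpha> *\<^sub>R s z)" "integrable D (\<lambda>z. (norm (\<alpha> *\<^sub>R s z))\<^sup>2)"
    using s s2 by (simp_all add: power_mult_distrib)
  show ?int unfolding step by (rule D.norm_diff_power2_expectation(1)[OF as])
  have "(\<integral>z. (norm (c - \<alpha> *\<^sub>R s z))\<^sup>2 \<partial>D) =
      (norm c)\<^sup>2 - (\<alpha> / F) * (2 * (c \<bullet> (A *v w))) + \<alpha>\<^sup>2 * (\<integral>z. (norm (s z))\<^sup>2 \<partial>D)"
    by (subst D.norm_diff_power2_expectation(2)[OF as])
       (simp add: power_mult_distrib s_mean algebra_simps)
  also have "\<dots> \<le> ((1 + 3 * \<omega> + 2 * \<omega>\<^sup>2) * (norm e)\<^sup>2 + (2 * \<omega>\<^sup>2 + \<omega>) * (norm d)\<^sup>2)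
      - (\<alpha> / F) * ((2 + \<omega>) * (norm w)\<^sup>2 - \<omega> * (norm (transpose A *v d))\<^sup>2)
      + \<alpha>\<^sup>2 * (\<rho>\<^sup>2 * \<beta>2 * (norm w)\<^sup>2)"
    unfolding c_def w_def using \<alpha> F \<omega> s2_le
    by (intro add_mono diff_mono mult_left_mono momentum_norm_le momentum_gradient_inner_ge)
       (auto simp: w_def)
  also have "\<dots> = (1 + 3 * \<omega> + 2 * \<omega>\<^sup>2) * (norm e)\<^sup>2 + (2 * \<omega>\<^sup>2 + \<omega>) * (norm d)\<^sup>2
      - ((2 * \<alpha> - \<alpha>\<^sup>2 * \<rho>\<^sup>2 * \<beta>2 * F + \<alpha> * \<omega>) / F) * (norm w)\<^sup>2
      + (\<omega> * \<alpha> / F) * (norm (transpose A *v d))\<^sup>2"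
    using F by (simp add: field_simps)
  \<comment> \<open>Replacing |w|^2 by its lower bound enlarges the expression only if its
    coefficient is nonnegative; this is where the upper bound on \<alpha> enters.\<close>
  also have "\<dots> \<le> (1 + 3 * \<omega> + 2 * \<omega>\<^sup>2) * (norm e)\<^sup>2 + (2 * \<omega>\<^sup>2 + \<omega>) * (norm d)\<^sup>2
      - ((2 * \<alpha> - \<alpha>\<^sup>2 * \<rho>\<^sup>2 * \<beta>2 * F + \<alpha> * \<omega>) / F) * ((sigma_min A)\<^sup>2 * (norm e)\<^sup>2)
      + (\<omega> * \<alpha> / F) * ((sigma_max A)\<^sup>2 * (norm d)\<^sup>2)"
  proof (intro add_mono diff_mono mult_left_mono)
    show "(sigma_min A)\<^sup>2 * (norm e)\<^sup>2 \<le> (norm w)\<^sup>2"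
      using norm_transpose_vector_mult_ge_sigma_min[OF A, of "x - xs"]
      by (simp add: w_def e_def matrix_vector_mult_diff_distrib)
    have "\<beta>2 \<ge> 0" unfolding \<beta>2 spectral_norm_def by (intro onorm_pos_le) auto
    \<comment> \<open>If \<open>\<beta>2 = 0\<close>, the upper bound on \<open>\<alpha>\<close> is \<open>2 / 0 = 0\<close>.\<close>
    with \<alpha> have "\<rho>\<^sup>2 * \<beta>2 * F > 0"
      using F \<rho> by (cases "\<beta>2 = 0") (auto simp: F_def)
    with \<alpha>(2) have "\<alpha> * (\<rho>\<^sup>2 * \<beta>2 * F) < 2"
      by (simp add: pos_less_divide_eq F_def)
    from mult_strict_left_mono[OF this \<alpha>(1)]
    have "\<alpha>\<^sup>2 * \<rho>\<^sup>2 * \<beta>2 * F < 2 * \<alpha>" by (simp add: power2_eq_square algebra_simps)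
    then show "0 \<le> (2 * \<alpha> - \<alpha>\<^sup>2 * \<rho>\<^sup>2 * \<beta>2 * F + \<alpha> * \<omega>) / F" using \<alpha> \<omega> F by simp
  qed (use \<alpha> \<omega> F in \<open>simp_all add: norm_transpose_vector_mult_le_sigma_max del: transpose_matrix_vector\<close>)
  also have "\<dots> = \<gamma>1 * (norm e)\<^sup>2 + \<gamma>2 * (norm d)\<^sup>2"
    unfolding \<gamma>1 \<gamma>2 F_def[symmetric] using F by (simp add: field_simps)
  finally show ?le unfolding step e_def d_def .
qed

subsection \<open>Iterations driven by independent samples\<close>

text \<open>
  Independence of \<open>X\<close> and \<open>Y\<close> is expressed here as the factorization of their joint law, because the
  library's \<open>indep_var\<close> is restricted to random variables of the same type.
\<close>

lemma (in prob_space) nn_integral_independent: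
  assumes X[measurable]: "X \<in> measurable M S" and Y[measurable]: "Y \<in> measurable M T"
    and ind: "distr M (S \<Otimes>\<^sub>M T) (\<lambda>\<xi>. (X \<xi>, Y \<xi>)) = distr M S X \<Otimes>\<^sub>M distr M T Y"
    and h[measurable]: "h \<in> borel_measurable (S \<Otimes>\<^sub>M T)"
  shows "(\<integral>\<^sup>+\<xi>. h (X \<xi>, Y \<xi>) \<partial>M) = (\<integral>\<^sup>+\<xi>. (\<integral>\<^sup>+z. h (X \<xi>, z) \<partial>distr M T Y) \<partial>M)"
proof -
  interpret Y: prob_space "distr M T Y" by (rule prob_space_distr) fact
  have "(\<integral>\<^sup>+\<xi>. h (X \<xi>, Y \<xi>) \<partial>M) = (\<integral>\<^sup>+u. h u \<partial>distr M (S \<Otimes>\<^sub>M T) (\<lambda>\<xi>. (X \<xi>, Y \<xi>)))"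
    by (simp add: nn_integral_distr)
  also have "\<dots> = (\<integral>\<^sup>+u. h u \<partial>(distr M S X \<Otimes>\<^sub>M distr M T Y))"
    by (simp add: ind)
  also have "\<dots> = (\<integral>\<^sup>+u. (\<integral>\<^sup>+z. h (u, z) \<partial>distr M T Y) \<partial>distr M S X)"
    by (rule Y.nn_integral_fst[symmetric]) simp
  also have "\<dots> = (\<integral>\<^sup>+\<xi>. (\<integral>\<^sup>+z. h (X \<xi>, z) \<partial>distr M T Y) \<partial>M)"
    by (intro nn_integral_distr X Y.borel_measurable_nn_integral) simp
  finally show ?thesis .
qed

text \<open>Integrates a bound that holds for each fixed value of \<open>X\<close>. As
  \<open>h\<close> is nonnegative, Tonelli applies before integrability is known, and the finite
  integral of \<open>g\<close> then delivers it.\<close>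

lemma (in prob_space) expectation_independent_le:
  fixes h :: "'b \<times> 'c \<Rightarrow> real"
  assumes X: "X \<in> measurable M S" and Y: "Y \<in> measurable M T"
    and ind: "distr M (S \<Otimes>\<^sub>M T) (\<lambda>\<xi>. (X \<xi>, Y \<xi>)) = distr M S X \<Otimes>\<^sub>M distr M T Y"
    and h: "h \<in> borel_measurable (S \<Otimes>\<^sub>M T)"
    and nonneg: "\<And>u. h u \<ge> 0"
    and int: "\<And>u. u \<in> space S \<Longrightarrow> integrable (distr M T Y) (\<lambda>z. h (u, z))"
    and le: "\<And>u. u \<in> space S \<Longrightarrow> (\<integral>z. h (u, z) \<partial>distr M T Y) \<le> g u"
    and g: "integrable M (\<lambda>\<xi>. g (X \<xi>))"
  shows "integrable M (\<lambda>\<xi>. h (X \<xi>, Y \<xi>))"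
    and "(\<integral>\<xi>. h (X \<xi>, Y \<xi>) \<partial>M) \<le> (\<integral>\<xi>. g (X \<xi>) \<partial>M)"
proof -
  \<comment> \<open>Along \<open>X\<close>, \<open>g\<close> dominates an integral of the
    nonnegative \<open>h\<close>; this permits passing to extended nonnegative integrals.\<close>
  have g_nonneg: "0 \<le> g (X \<xi>)" if "\<xi> \<in> space M" for \<xi>
  proof -
    have "0 \<le> (\<integral>z. h (X \<xi>, z) \<partial>distr M T Y)"
      by (rule Bochner_Integration.integral_nonneg) (rule nonneg)
    also have "\<dots> \<le> g (X \<xi>)" by (rule le[OF measurable_space[OF X that]])
    finally show ?thesis .
  qed
  have "(\<integral>\<^sup>+\<xi>. ennreal (h (X \<xi>, Y \<xi>)) \<partial>M) =
      (\<integral>\<^sup>+\<xi>. (\<integral>\<^sup>+z. ennreal (h (X \<xi>, z)) \<partial>distr M T Y) \<partial>M)"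
    using h by (intro nn_integral_independent[OF X Y ind, where h = "\<lambda>u. ennreal (h u)"]) simp
  also have "\<dots> \<le> (\<integral>\<^sup>+\<xi>. ennreal (g (X \<xi>)) \<partial>M)"
  proof (rule nn_integral_mono)
    fix \<xi> assume "\<xi> \<in> space M"
    then have "X \<xi> \<in> space S" using X by (rule measurable_space[rotated])
    then show "(\<integral>\<^sup>+z. ennreal (h (X \<xi>, z)) \<partial>distr M T Y) \<le> ennreal (g (X \<xi>))"
      by (simp add: nn_integral_eq_integral int nonneg le ennreal_leI)
  qed
  also have "\<dots> = ennreal (\<integral>\<xi>. g (X \<xi>) \<partial>M)"
    by (intro nn_integral_eq_integral g AE_I2 g_nonneg)
  finally have *: "(\<integral>\<^sup>+\<xi>. ennreal (h (X \<xi>, Y \<xi>)) \<partial>M) \<le> ennreal (\<integral>\<xi>. g (X \<xi>) \<partial>M)" .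
  have meas: "(\<lambda>\<xi>. h (X \<xi>, Y \<xi>)) \<in> borel_measurable M"
    using measurable_compose[OF measurable_Pair[OF X Y] h] .
  show int': "integrable M (\<lambda>\<xi>. h (X \<xi>, Y \<xi>))"
    using meas * by (intro integrableI_nonneg) (auto simp: nonneg less_top[symmetric] top_unique)
  have "0 \<le> (\<integral>\<xi>. g (X \<xi>) \<partial>M)"
    by (intro integral_nonneg_AE AE_I2 g_nonneg)
  then show "(\<integral>\<xi>. h (X \<xi>, Y \<xi>) \<partial>M) \<le> (\<integral>\<xi>. g (X \<xi>) \<partial>M)"
    using * by (simp add: nn_integral_eq_integral[OF int'] nonneg)
qed

text \<open>The state at time \<open>k\<close> is a measurable function of the samples 1, ..., k - 1
  alone, hence independent of sample \<open>k\<close>.\<close>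

lemma (in prob_space) markov_iterate_independent:
  assumes ind: "indep_vars (\<lambda>_. N) Q {1..}"
    and step_meas: "\<Phi> \<in> measurable (S \<Otimes>\<^sub>M N) S" and s1: "s1 \<in> space S"
    and start: "\<And>\<xi>. \<xi> \<in> space M \<Longrightarrow> X 1 \<xi> = s1"
    and step: "\<And>k \<xi>. k \<ge> 1 \<Longrightarrow> \<xi> \<in> space M \<Longrightarrow> X (Suc k) \<xi> = \<Phi> (X k \<xi>, Q k \<xi>)"
    and k: "(k::nat) \<ge> 1"
  shows "X k \<in> measurable M S"
    and "distr M (S \<Otimes>\<^sub>M N) (\<lambda>\<xi>. (X k \<xi>, Q k \<xi>)) = distr M S (X k) \<Otimes>\<^sub>M distr M N (Q k)"
proof -
  have "\<exists>f\<in>measurable (PiM {1..<k} (\<lambda>_. N)) S.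
      \<forall>\<xi>\<in>space M. X k \<xi> = f (restrict (\<lambda>i. Q i \<xi>) {1..<k})"
    using k
  proof (induction k rule: dec_induct)
    case base
    \<comment> \<open>At time 1 no sample has been used: the index set is empty and the function is
      constant.\<close>
    show ?case by (rule bexI[of _ "\<lambda>_. s1"]) (use start s1 in auto)
  next
    case (step n)
    then obtain f where f: "f \<in> measurable (PiM {1..<n} (\<lambda>_. N)) S"
      and X: "\<And>\<xi>. \<xi> \<in> space M \<Longrightarrow> X n \<xi> = f (restrict (\<lambda>i. Q i \<xi>) {1..<n})"
      by blast
    have "(\<lambda>p. restrict p {1..<n}) \<in> measurable (PiM {1..<Suc n} (\<lambda>_. N)) (PiM {1..<n} (\<lambda>_. N))"
      by (rule measurable_restrict_subset) auto
    moreover have "(\<lambda>p. p n) \<in> measurable (PiM {1..<Suc n} (\<lambda>_. N)) N"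
      using step.hyps by (intro measurable_component_singleton) auto
    ultimately have meas: "(\<lambda>p. \<Phi> (f (restrict p {1..<n}), p n)) \<in> measurable (PiM {1..<Suc n} (\<lambda>_. N)) S"
      by (intro measurable_compose[OF _ step_meas] measurable_Pair measurable_compose[OF _ f])
    have eq: "X (Suc n) \<xi> = \<Phi> (f (restrict (restrict (\<lambda>i. Q i \<xi>) {1..<Suc n}) {1..<n}),
        restrict (\<lambda>i. Q i \<xi>) {1..<Suc n} n)" if "\<xi> \<in> space M" for \<xi>
    proof -
      have "{1..<Suc n} \<inter> {1..<n} = {1..<n}" by auto
      then show ?thesis
        using assms(5)[OF step.hyps(1) that] X[OF that] step.hyps by simp
    qed
    show ?case by (rule bexI[OF _ meas], rule ballI, erule eq)
  qed
  then obtain f where f: "f \<in> measurable (PiM {1..<k} (\<lambda>_. N)) S"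
    and X: "\<And>\<xi>. \<xi> \<in> space M \<Longrightarrow> X k \<xi> = f (restrict (\<lambda>i. Q i \<xi>) {1..<k})"
    by blast
  \<comment> \<open>The disjoint blocks \<open>{1..<k}\<close> and \<open>{k}\<close> of samples are
    independent; their product law is then pushed forward by \<open>f\<close> and by evaluation at
    \<open>k\<close>.\<close>
  define V where "V J \<xi> = restrict (\<lambda>i. Q i \<xi>) J" for J \<xi>
  have "indep_var (PiM {1..<k} (\<lambda>_. N)) (V {1..<k}) (PiM {k} (\<lambda>_. N)) (V {k})"
    unfolding V_def using k by (intro indep_var_restrict[OF ind]) auto
  then have V1: "V {1..<k} \<in> measurable M (PiM {1..<k} (\<lambda>_. N))"
    and V2: "V {k} \<in> measurable M (PiM {k} (\<lambda>_. N))"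
    and prod: "distr M (PiM {1..<k} (\<lambda>_. N) \<Otimes>\<^sub>M PiM {k} (\<lambda>_. N)) (\<lambda>\<xi>. (V {1..<k} \<xi>, V {k} \<xi>)) =
      distr M (PiM {1..<k} (\<lambda>_. N)) (V {1..<k}) \<Otimes>\<^sub>M distr M (PiM {k} (\<lambda>_. N)) (V {k})"
    by (simp_all add: indep_var_distribution_eq)
  have X: "X k \<xi> = f (V {1..<k} \<xi>)" if "\<xi> \<in> space M" for \<xi>
    using X[OF that] by (simp add: V_def)
  have g: "(\<lambda>p. p k) \<in> measurable (PiM {k} (\<lambda>_. N)) N"
    by (rule measurable_component_singleton) simp
  have fV: "(\<lambda>\<xi>. f (V {1..<k} \<xi>)) \<in> measurable M S" by (rule measurable_compose[OF V1 f])
  then show "X k \<in> measurable M S" using X by (simp cong: measurable_cong)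
  have Qk: "Q k = (\<lambda>\<xi>. V {k} \<xi> k)" by (simp add: V_def)
  have Q_meas: "Q k \<in> measurable M N" unfolding Qk by (rule measurable_compose[OF V2 g])
  have distr_X: "distr M S (X k) = distr (distr M (PiM {1..<k} (\<lambda>_. N)) (V {1..<k})) S f"
    unfolding distr_distr[OF f V1] comp_def using X by (intro distr_cong) auto
  have distr_Q: "distr M N (Q k) = distr (distr M (PiM {k} (\<lambda>_. N)) (V {k})) N (\<lambda>p. p k)"
    by (simp add: distr_distr[OF g V2] comp_def Qk)
  \<comment> \<open>Sigma-finiteness of the second image measure lets the product of images be
    rewritten as the image of the product.\<close>
  have "prob_space (distr M N (Q k))" by (rule prob_space_distr[OF Q_meas])
  then have "sigma_finite_measure (distr (distr M (PiM {k} (\<lambda>_. N)) (V {k})) N (\<lambda>p. p k))"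
    unfolding distr_Q by (simp add: prob_space_imp_sigma_finite)
  then have "distr M S (X k) \<Otimes>\<^sub>M distr M N (Q k) =
      distr (distr M (PiM {1..<k} (\<lambda>_. N) \<Otimes>\<^sub>M PiM {k} (\<lambda>_. N)) (\<lambda>\<xi>. (V {1..<k} \<xi>, V {k} \<xi>)))
        (S \<Otimes>\<^sub>M N) (\<lambda>(p, p'). (f p, p' k))"
    unfolding distr_X distr_Q prod using f g by (intro pair_measure_distr) simp_all
  also have "\<dots> = distr M (S \<Otimes>\<^sub>M N) (\<lambda>\<xi>. (f (V {1..<k} \<xi>), Q k \<xi>))"
    unfolding Qk using f g V1 V2 by (subst distr_distr) (auto simp: comp_def)
  also have "\<dots> = distr M (S \<Otimes>\<^sub>M N) (\<lambda>\<xi>. (X k \<xi>, Q k \<xi>))"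
    using X by (intro distr_cong) auto
  finally show "distr M (S \<Otimes>\<^sub>M N) (\<lambda>\<xi>. (X k \<xi>, Q k \<xi>)) = distr M S (X k) \<Otimes>\<^sub>M distr M N (Q k)" ..
qed

text \<open>The identity (q - a) q = b makes F (k+1) + (q - a) F k contract by \<open>q\<close>;
  since F 1 = F 0, its initial value is (1 + (q - a)) F 0.\<close>

lemma two_step_recurrence:
  fixes a b q :: real
  assumes a: "a \<ge> 0" and b: "b \<ge> 0" and ab: "a + b < 1"
    and q: "q = (a + sqrt (a\<^sup>2 + 4 * b)) / 2"
  shows "q \<ge> a" "a + b \<le> q" "q < 1"
    and "\<lbrakk>\<And>k. F k \<ge> 0; F 1 = F 0; \<And>k. F (Suc (Suc k)) \<le> a * F (Suc k) + b * F k\<rbrakk>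
      \<Longrightarrow> F (Suc k) \<le> q ^ k * (1 + (q - a)) * F 0"
proof -
  have sq: "sqrt (a\<^sup>2 + 4 * b) \<ge> a" using a b by (intro real_le_rsqrt) auto
  then show qa: "q \<ge> a" by (simp add: q)
  \<comment> \<open>Expanding and cancelling a^2 leaves \<open>a + b < 1\<close>.\<close>
  have "a\<^sup>2 + 4 * b < (2 - a)\<^sup>2" using ab by (simp add: power2_eq_square algebra_simps)
  then have "sqrt (a\<^sup>2 + 4 * b) < 2 - a" using a b ab by (intro real_less_lsqrt) auto
  then show q1: "q < 1" by (simp add: q)
  have "2 * q - a = sqrt (a\<^sup>2 + 4 * b)" by (simp add: q field_simps)
  then have "(2 * q - a)\<^sup>2 = a\<^sup>2 + 4 * b" using b by simp
  then have root: "(q - a) * q = b" by (simp add: power2_eq_square algebra_simps)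
  \<comment> \<open>By \<open>root\<close> the left side is \<open>b\<close>, so this says b \<le> q
    - a.\<close>
  have "(q - a) * q \<le> (q - a) * 1" using qa q1 by (intro mult_left_mono) auto
  then show "a + b \<le> q" using root by simp
  assume F: "\<And>k. F k \<ge> 0" "F 1 = F 0" "\<And>k. F (Suc (Suc k)) \<le> a * F (Suc k) + b * F k"
  have "F (Suc k) + (q - a) * F k \<le> q ^ k * ((1 + (q - a)) * F 0)" for k
  proof (induction k)
    case 0
    show ?case using F(2) by (simp add: algebra_simps)
  next
    case (Suc k)
    have "F (Suc (Suc k)) + (q - a) * F (Suc k) \<le> q * F (Suc k) + b * F k"
      using F(3)[of k] by (simp add: algebra_simps)
    also have "\<dots> = q * (F (Suc k) + (q - a) * F k)"
      by (simp add: root[symmetric] algebra_simps)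
    also have "\<dots> \<le> q * (q ^ k * ((1 + (q - a)) * F 0))"
      using Suc qa a by (intro mult_left_mono) auto
    finally show ?case by (simp add: mult.assoc)
  qed
  from this[of k] show "F (Suc k) \<le> q ^ k * (1 + (q - a)) * F 0"
    using qa F(1)[of k] mult_nonneg_nonneg[of "q - a" "F k"] unfolding mult.assoc by linarith
qed

subsection \<open>The residual recursion\<close>

lemma borel_measurable_matrix_vector_mult:
  fixes f :: "'a \<Rightarrow> real^'n^'m"
  assumes "f \<in> borel_measurable M" "g \<in> borel_measurable M"
  shows "(\<lambda>x. f x *v g x) \<in> borel_measurable M"
proof (rule borel_measurable_continuous_Pair[OF assms])
  show "continuous_on UNIV (\<lambda>x :: (real^'n^'m) \<times> (real^'n). fst x *v snd x)"
    unfolding matrix_vector_mult_def by (intro continuous_intros)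
qed

lemma mpfr_step_measurable:
  fixes A :: "real^'n^'m"
  assumes [measurable]: "sketch_matrix A \<in> borel_measurable N"
  shows "(\<lambda>(s, z). mpfr_step A b \<alpha> \<omega> s z) \<in> borel_measurable (borel \<Otimes>\<^sub>M N)"
proof -
  have [measurable]: "(\<lambda>u :: ((real^'n) \<times> (real^'n)) \<times> ('m, 'n) quadruple. fst (fst u)) \<in> borel_measurable (borel \<Otimes>\<^sub>M N)"
    "(\<lambda>u :: ((real^'n) \<times> (real^'n)) \<times> ('m, 'n) quadruple. snd (fst u)) \<in> borel_measurable (borel \<Otimes>\<^sub>M N)"
    by (auto intro!: measurable_compose[OF measurable_fst] borel_measurable_continuous_onI continuous_intros)
  have [measurable]: "(\<lambda>u :: ((real^'n) \<times> (real^'n)) \<times> ('m, 'n) quadruple. A *v fst (fst u)) \<in> borel_measurable (borel \<Otimes>\<^sub>M N)"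
    by (intro borel_measurable_matrix_vector_mult) measurable
  have "(\<lambda>u. sketch_matrix A (snd u) *v (A *v fst (fst u) - b))
      \<in> borel_measurable ((borel :: ((real^'n) \<times> (real^'n)) measure) \<Otimes>\<^sub>M N)"
    by (intro borel_measurable_matrix_vector_mult) measurable
  then show ?thesis
    unfolding mpfr_step_def case_prod_unfold by measurable
qed

theorem theorem4p6:
  fixes A :: "real^'n^'m" and b :: "real^'m"
    and D :: "('m, 'n) quadruple measure"
    and M :: "'w measure" and Q :: "nat \<Rightarrow> 'w \<Rightarrow> ('m, 'n) quadruple"
    and x :: "nat \<Rightarrow> 'w \<Rightarrow> real^'n" and x0 xLS :: "real^'n"
    and rstar :: "real^'m" and r :: "nat \<Rightarrow> 'w \<Rightarrow> real^'m"
    and \<rho> \<alpha> \<omega> \<beta>2 \<gamma>1 \<gamma>2 q \<tau> :: real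
  assumes A_nonzero: "A \<noteq> 0"
    and rho_pos: "\<rho> > 0"
    and D_prob: "prob_space D" and D_sets: "sets D = sets quadruple_space"
    and D_same_width: "AE (S1, S2, T1, T2) in D. length T1 = length T2"
    and D_S: "AE (S1, S2, T1, T2) in D. S1 = sqrt \<rho> *\<^sub>R mat 1 \<and> S2 = sqrt \<rho> *\<^sub>R mat 1"
    and D_sketch_integrable: "integrable D (sketch_matrix A)"
    and D_sketch_mean: "(\<integral>z. sketch_matrix A z \<partial>D) = (1 / (frobenius_norm A)\<^sup>2) *\<^sub>R transpose A"
    and D_gram_integrable: "integrable D (gram_matrix A)"
    and M_prob: "prob_space M"
    and Q_indep: "prob_space.indep_vars M (\<lambda>_. quadruple_space) Q {1..}"
    and Q_distr: "\<And>k. k \<ge> 1 \<Longrightarrow> distr M quadruple_space (Q k) = D"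
    and x_0: "\<And>\<xi>. \<xi> \<in> space M \<Longrightarrow> x 0 \<xi> = x0"
    and x_1: "\<And>\<xi>. \<xi> \<in> space M \<Longrightarrow> x 1 \<xi> = x0"
    and x_step: "\<And>k \<xi>. k \<ge> 1 \<Longrightarrow> \<xi> \<in> space M \<Longrightarrow>
      x (k + 1) \<xi> = x k \<xi> - \<alpha> *\<^sub>R (sketch_matrix A (Q k \<xi>) *v (A *v x k \<xi> - b))
        + \<omega> *\<^sub>R (x k \<xi> - x (k - 1) \<xi>)"
    and xLS_eq: "xLS = pseudoinverse A *v b"
    and rstar_eq: "rstar = A *v xLS - b"
    and r_eq: "\<And>k \<xi>. r k \<xi> = A *v x k \<xi> - b"
    and beta2_eq: "\<beta>2 = spectral_norm (\<integral>z. gram_matrix A z \<partial>D)"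
    and alpha_pos: "0 < \<alpha>" and alpha_less: "\<alpha> < 2 / (\<rho>\<^sup>2 * \<beta>2 * (frobenius_norm A)\<^sup>2)"
    and omega_nonneg: "\<omega> \<ge> 0"
    and gamma1_eq: "\<gamma>1 = 1 + 3 * \<omega> + 2 * \<omega>\<^sup>2
      - (2 * \<alpha> - \<alpha>\<^sup>2 * \<rho>\<^sup>2 * \<beta>2 * (frobenius_norm A)\<^sup>2 + \<alpha> * \<omega>)
        * ((sigma_min A)\<^sup>2 / (frobenius_norm A)\<^sup>2)"
    and gamma2_eq: "\<gamma>2 = 2 * \<omega>\<^sup>2 + \<omega> + \<omega> * \<alpha> * ((sigma_max A)\<^sup>2 / (frobenius_norm A)\<^sup>2)"
    and gamma_sum: "\<gamma>1 + \<gamma>2 < 1"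
    and q_eq: "q = (if \<omega> > 0 then (\<gamma>1 + sqrt (\<gamma>1\<^sup>2 + 4 * \<gamma>2)) / 2 else \<gamma>1)"
    and tau_eq: "\<tau> = q - \<gamma>1"
  shows "(\<forall>k. integrable M (\<lambda>\<xi>. (norm (r (k + 1) \<xi> - rstar))\<^sup>2) \<and>
            (\<integral>\<xi>. (norm (r (k + 1) \<xi> - rstar))\<^sup>2 \<partial>M)
              \<le> q ^ k * (1 + \<tau>) * (norm ((A *v x0 - b) - rstar))\<^sup>2)
         \<and> \<tau> \<ge> 0 \<and> \<gamma>1 + \<gamma>2 \<le> q \<and> q < 1"
proof -
  interpret M: prob_space M by (rule M_prob)
  define err where "err u = (norm (A *v u - A *v xLS))\<^sup>2" for u
  define F where "F k = (\<integral>\<xi>. err (x k \<xi>) \<partial>M)" for k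
  have ls: "transpose A *v (A *v xLS) = transpose A *v b"
    unfolding xLS_eq by (rule pseudoinverse_normal_equation)
  note contraction = mpfr_step_residual_contraction[OF A_nonzero rho_pos D_prob D_same_width D_S
      D_sketch_integrable D_sketch_mean D_gram_integrable beta2_eq alpha_pos alpha_less omega_nonneg
      gamma1_eq gamma2_eq ls, folded err_def]
  have res: "(norm (r k \<xi> - rstar))\<^sup>2 = err (x k \<xi>)" for k \<xi>
    by (simp add: r_eq rstar_eq err_def)

  have \<gamma>2: "\<gamma>2 \<ge> 0" using alpha_pos omega_nonneg by (simp add: gamma2_eq)
  \<comment> \<open>The contraction estimate is tested at a state whose previous error is zero and
    whose current error is \<open>A *v v\<close>, nonzero: a nonnegative mean is then at most
    \<gamma>1 |A v|^2.\<close>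
  have \<gamma>1: "\<gamma>1 \<ge> 0"
  proof -
    obtain v where v: "A *v v \<noteq> 0"
      using A_nonzero by (metis matrix_eq matrix_vector_mult_0)
    have "0 \<le> (\<integral>z. err (mpfr_step A b \<alpha> \<omega> (xLS + v, xLS) z) \<partial>D)"
      by (rule Bochner_Integration.integral_nonneg) (simp add: err_def)
    also have "\<dots> \<le> \<gamma>1 * err (xLS + v) + \<gamma>2 * err xLS" by (rule contraction(2))
    finally show ?thesis
      using v by (simp add: err_def matrix_vector_right_distrib zero_le_mult_iff)
  qed
  \<comment> \<open>For \<open>\<omega> = 0\<close> this uses \<open>\<gamma>2 = 0\<close> and \<open>\<gamma>1 \<ge> 0\<close>.\<close>
  have q: "q = (\<gamma>1 + sqrt (\<gamma>1\<^sup>2 + 4 * \<gamma>2)) / 2"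
    using q_eq omega_nonneg \<gamma>1 by (cases "\<omega> = 0") (simp_all add: gamma2_eq)

  \<comment> \<open>Transition map of the chain of pairs: the new iterate is put in front and the
    current one becomes the previous one.\<close>
  define \<Phi> where "\<Phi> = (\<lambda>(s, z). (mpfr_step A b \<alpha> \<omega> s z, fst s))"
  \<comment> \<open>Integrability includes measurability, which depends only on the sigma-algebra
    and so passes from \<open>D\<close> to \<open>quadruple_space\<close>.\<close>
  have "sketch_matrix A \<in> borel_measurable D" using D_sketch_integrable by simp
  then have "sketch_matrix A \<in> borel_measurable quadruple_space"
    using D_sets by (simp cong: measurable_cong_sets)
  note step_meas = mpfr_step_measurable[OF this, of b \<alpha> \<omega>]
  have \<Phi>: "\<Phi> \<in> measurable (borel \<Otimes>\<^sub>M quadruple_space) borel"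
    unfolding \<Phi>_def case_prod_unfold
    using step_meas
    by (intro borel_measurable_Pair measurable_compose[OF measurable_fst])
       (auto simp: case_prod_unfold intro!: borel_measurable_continuous_onI continuous_intros)
  have Q_meas: "Q k \<in> measurable M quadruple_space" if "k \<ge> 1" for k
    using Q_indep that by (simp add: M.indep_vars_def)
  \<comment> \<open>The chain starts at time 1 with both components equal to \<open>x0\<close>;
    sample \<open>Q k\<close> drives the passage from time \<open>k\<close> to
    \<open>k + 1\<close>.\<close>
  have start: "(x 1 \<xi>, x (1 - 1) \<xi>) = (x0, x0)" if "\<xi> \<in> space M" for \<xi>
    using x_0[OF that] x_1[OF that] by simp
  have next_state: "(x (Suc k) \<xi>, x (Suc k - 1) \<xi>) = \<Phi> ((x k \<xi>, x (k - 1) \<xi>), Q k \<xi>)"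
    if "k \<ge> 1" "\<xi> \<in> space M" for k \<xi>
    using x_step[OF that] by (simp add: \<Phi>_def mpfr_step_def)
  have s0: "(x0, x0) \<in> space borel" by simp
  note independent = M.markov_iterate_independent[where X = "\<lambda>k \<xi>. (x k \<xi>, x (k - 1) \<xi>)",
      OF Q_indep \<Phi> s0]
  have state_meas: "(\<lambda>\<xi>. (x k \<xi>, x (k - 1) \<xi>)) \<in> borel_measurable M" if "k \<ge> 1" for k
    using start next_state that by (rule independent(1))
  have state_indep: "distr M (borel \<Otimes>\<^sub>M quadruple_space) (\<lambda>\<xi>. ((x k \<xi>, x (k - 1) \<xi>), Q k \<xi>)) =
      distr M borel (\<lambda>\<xi>. (x k \<xi>, x (k - 1) \<xi>)) \<Otimes>\<^sub>M distr M quadruple_space (Q k)"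
    if "k \<ge> 1" for k
    using start next_state that by (rule independent(2))
  have err_meas: "err \<in> borel_measurable borel"
    unfolding err_def by (intro borel_measurable_continuous_onI continuous_intros
        matrix_vector_mult_linear_continuous_on)
  have h_meas: "(\<lambda>(s, z). err (mpfr_step A b \<alpha> \<omega> s z)) \<in> borel_measurable (borel \<Otimes>\<^sub>M quadruple_space)"
    using measurable_compose[OF step_meas err_meas] by (simp add: case_prod_unfold)

  have step: "integrable M (\<lambda>\<xi>. err (x (Suc k) \<xi>)) \<and> F (Suc k) \<le> \<gamma>1 * F k + \<gamma>2 * F (k - 1)"
    if k: "k \<ge> 1" and int: "integrable M (\<lambda>\<xi>. err (x k \<xi>))" "integrable M (\<lambda>\<xi>. err (x (k - 1) \<xi>))" for k
  proof -
    \<comment> \<open>The conditional bound as a function of the state; its integrability comes from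
      the two preceding errors.\<close>
    define g where "g = (\<lambda>(u, v). \<gamma>1 * err u + \<gamma>2 * err v)"
    have g: "integrable M (\<lambda>\<xi>. g (x k \<xi>, x (k - 1) \<xi>))"
      using int by (simp add: g_def)
    have eq: "err (x (Suc k) \<xi>) = err (mpfr_step A b \<alpha> \<omega> (x k \<xi>, x (k - 1) \<xi>) (Q k \<xi>))"
      if "\<xi> \<in> space M" for \<xi>
      using x_step[OF k that] by (simp add: mpfr_step_def)
    note le = M.expectation_independent_le[OF state_meas[OF k] Q_meas[OF k] state_indep[OF k] h_meas,
        where g = g, unfolded Q_distr[OF k] prod.case]
    have 1: "integrable M (\<lambda>\<xi>. err (mpfr_step A b \<alpha> \<omega> (x k \<xi>, x (k - 1) \<xi>) (Q k \<xi>)))"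
      by (rule le(1)) (use contraction g in \<open>auto simp: g_def err_def[abs_def]\<close>)
    have 2: "(\<integral>\<xi>. err (mpfr_step A b \<alpha> \<omega> (x k \<xi>, x (k - 1) \<xi>) (Q k \<xi>)) \<partial>M)
        \<le> (\<integral>\<xi>. g (x k \<xi>, x (k - 1) \<xi>) \<partial>M)"
      by (rule le(2)) (use contraction g in \<open>auto simp: g_def err_def[abs_def]\<close>)
    have "(\<integral>\<xi>. g (x k \<xi>, x (k - 1) \<xi>) \<partial>M) = \<gamma>1 * F k + \<gamma>2 * F (k - 1)"
      using int by (simp add: g_def F_def)
    with 1 2 show ?thesis
      unfolding F_def by (simp add: eq cong: Bochner_Integration.integrable_cong Bochner_Integration.integral_cong)
  qed
  have int01: "integrable M (\<lambda>\<xi>. err (x 0 \<xi>))" "integrable M (\<lambda>\<xi>. err (x 1 \<xi>))"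
    and F01: "F 0 = err x0" "F 1 = err x0"
    using x_0 x_1 unfolding F_def
    by (simp_all cong: Bochner_Integration.integrable_cong Bochner_Integration.integral_cong
        add: M.prob_space)
  \<comment> \<open>\<open>step\<close> consumes integrability at two consecutive indices, so the
    induction carries both.\<close>
  have int: "integrable M (\<lambda>\<xi>. err (x k \<xi>)) \<and> integrable M (\<lambda>\<xi>. err (x (Suc k) \<xi>))" for k
    by (induction k) (use int01 step[of "Suc _"] in auto)
  have "F (Suc k) \<le> q ^ k * (1 + (q - \<gamma>1)) * F 0" for k
  proof (rule two_step_recurrence(4)[OF \<gamma>1 \<gamma>2 gamma_sum q])
    show "F j \<ge> 0" for j unfolding F_def err_def by (rule Bochner_Integration.integral_nonneg) simp
    show "F (Suc (Suc j)) \<le> \<gamma>1 * F (Suc j) + \<gamma>2 * F j" for j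
      using step[of "Suc j"] int[of j] by simp
    show "F 1 = F 0" by (simp only: F01)
  qed
  then show ?thesis
    using int two_step_recurrence(1-3)[OF \<gamma>1 \<gamma>2 gamma_sum q]
    by (simp add: res F_def[symmetric] F01 tau_eq) (simp add: err_def rstar_eq)
qed

end
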